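(* Let $E$ be a $\sigma$-orthocomplete atomic effect algebra with the Riesz Decomposition Property (RDP), and let $A(E)=\{a_i\mid i\in I\}$ be the set of all atoms of $E$ (indexed without repetition), which is assumed to be at most countable. Let $\imath_i$ be the isotropic index of $a_i\in A(E)$. For any $i\in I$ define $s_i:E\to[0,1]$ by $$s_i(a)=\max\{j\mid j a_i\leqslant a\wedge \imath_i a_i\}/\imath_i,\qquad a\in E.$$ Then: (1) each $s_i$ is an extremal state on $E$ which is also $\sigma$-additive; (2) if $s$ is a $\sigma$-additive state on $E$, then $s(a)=\sum_{i}\lambda_i s_i(a)$ for all $a\in E$, where $\lambda_i=s(\imath_i a_i)$; (3) every extremal state on $E$ that is also $\sigma$-additive is of the form $s_i$ for a unique $i\in I$; (4) for a state $s$ on $E$ and $i\in I$, $s=s_i$ if and only if $s(\imath_i a_i)=1$.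
   Context: An effect algebra is a system $(E;+,0,1)$ with elements $0,1\in E$ and a partial binary operation $+$ such that for all $a,b,c\in E$: (E1) if $a+b$ is defined then $b+a$ is defined and $a+b=b+a$; (E2) if $a+b$ and $(a+b)+c$ are defined, then $b+c$ and $a+(b+c)$ are defined and $(a+b)+c=a+(b+c)$; (E3) for each $a$ there is a unique $b$, denoted $a'$, such that $a+b$ is defined and $a+b=1$; (E4) if $a+1$ is defined then $a=0$. The partial order is $a\leqslant b$ iff $c+a=b$ for some $c\in E$. RDP: whenever $a_1+a_2=b_1+b_2$ in $E$, there are $c_{11},c_{12},c_{21},c_{22}\in E$ with $a_i=c_{i1}+c_{i2}$ and $b_j=c_{1j}+c_{2j}$ for $i,j\in\{1,2\}$. An atom of $E$ is an element $a\neq 0$ such that $\{x\in E\mid 0\leqslant x\leqslant a\}=\{0,a\}$. $E$ is atomic if for every nonzero $x\in E$ there is an atom $a\leqslant x$. For an integer $n\ge 0$: $0a=0$, $1a=a$, $na=(n-1)a+a$ if defined. The isotropic index of $a$ is the maximal $n\ge0$ such that $na$ exists in $E$ ($+\infty$ if $na$ exists for all $n$). (In the setting of the claim isotropic indices of atoms are finite and the meets $a\wedge\imath_i a_i$ exist.) A finite sequence $(a_1,\dots,a_n)$ is orthogonal if $a_1+\cdots+a_n$ exists in $E$. A system of (not necessarily different) elements is orthogonal if every finite subsystem is orthogonal; its sum is the supremum of the sums of its finite subsystems, if it exists. $E$ is $\sigma$-orthocomplete if every countable orthogonal system has a sum. A state on $E$ is a mapping $s:E\to[0,1]$ with $s(a+b)=s(a)+s(b)$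 whenever $a+b$ is defined in $E$, and $s(1)=1$. A state $s$ is extremal if for all states $s_1,s_2$ and $\alpha\in(0,1)$, $s=\alpha s_1+(1-\alpha)s_2$ implies $s=s_1=s_2$. A state $s$ is $\sigma$-additive if for every increasing sequence $a_1\leqslant a_2\leqslant\cdots$ in $E$ with $\bigvee_i a_i=a$ existing in $E$, $s(a)=\lim_i s(a_i)$. *)

theory Defs
  imports "HOL-Analysis.Infinite_Sum" "HOL-Algebra.Lattice"
begin

section \<open>Effect algebras\<close>

text \<open>The partial operation is option-valued: \<open>a \<boxplus>\<^bsub>E\<^esub> b = Some c\<close> means that the sum of
  \<open>a\<close> and \<open>b\<close> is defined and equals \<open>c\<close>. Its values outside the carrier are irrelevant.\<close>

record 'a effect_struct = "'a partial_object" +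
  eplus :: "'a \<Rightarrow> 'a \<Rightarrow> 'a option" (infixl \<open>\<boxplus>\<index>\<close> 65)
  ezero :: 'a
  eone :: 'a

locale effect_algebra =
  fixes E (structure)
  assumes zero_closed: "ezero E \<in> carrier E"
    and one_closed: "eone E \<in> carrier E"
    and plus_closed: "\<lbrakk>a \<in> carrier E; b \<in> carrier E; a \<boxplus> b = Some c\<rbrakk> \<Longrightarrow> c \<in> carrier E"
    and E1: "\<lbrakk>a \<in> carrier E; b \<in> carrier E; a \<boxplus> b = Some c\<rbrakk> \<Longrightarrow> b \<boxplus> a = Some c"
    and E2: "\<lbrakk>a \<in> carrier E; b \<in> carrier E; c \<in> carrier E;
               a \<boxplus> b = Some d; d \<boxplus> c = Some e\<rbrakk>
             \<Longrightarrow> \<exists>f. b \<boxplus> c = Some f \<and> a \<boxplus> f = Some e"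
    and E3: "a \<in> carrier E \<Longrightarrow> \<exists>!b. b \<in> carrier E \<and> a \<boxplus> b = Some (eone E)"
    and E4: "\<lbrakk>a \<in> carrier E; a \<boxplus> eone E = Some c\<rbrakk> \<Longrightarrow> a = ezero E"

definition effect_order :: "('a, 'm) effect_struct_scheme \<Rightarrow> 'a gorder" where
  "effect_order E =
     \<lparr>carrier = carrier E, eq = (=), le = (\<lambda>a b. \<exists>c\<in>carrier E. c \<boxplus>\<^bsub>E\<^esub> a = Some b)\<rparr>"

definition RDP :: "('a, 'm) effect_struct_scheme \<Rightarrow> bool" where
  "RDP E \<longleftrightarrow>
    (\<forall>a1\<in>carrier E. \<forall>a2\<in>carrier E. \<forall>b1\<in>carrier E. \<forall>b2\<in>carrier E. \<forall>t.
       a1 \<boxplus>\<^bsub>E\<^esub> a2 = Some t \<and> b1 \<boxplus>\<^bsub>E\<^esub> b2 = Some t \<longrightarrow>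
       (\<exists>c11\<in>carrier E. \<exists>c12\<in>carrier E. \<exists>c21\<in>carrier E. \<exists>c22\<in>carrier E.
          c11 \<boxplus>\<^bsub>E\<^esub> c12 = Some a1 \<and> c21 \<boxplus>\<^bsub>E\<^esub> c22 = Some a2 \<and>
          c11 \<boxplus>\<^bsub>E\<^esub> c21 = Some b1 \<and> c12 \<boxplus>\<^bsub>E\<^esub> c22 = Some b2))"

definition eatoms :: "('a, 'm) effect_struct_scheme \<Rightarrow> 'a set" where
  "eatoms E = {a \<in> carrier E. a \<noteq> ezero E \<and>
     {x \<in> carrier E. ezero E \<sqsubseteq>\<^bsub>effect_order E\<^esub> x \<and> x \<sqsubseteq>\<^bsub>effect_order E\<^esub> a} = {ezero E, a}}"

definition eatomic :: "('a, 'm) effect_struct_scheme \<Rightarrow> bool" where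
  "eatomic E \<longleftrightarrow>
     (\<forall>x\<in>carrier E. x \<noteq> ezero E \<longrightarrow> (\<exists>a\<in>eatoms E. a \<sqsubseteq>\<^bsub>effect_order E\<^esub> x))"


section \<open>Multiples and sums of systems\<close>

fun nmult :: "('a, 'm) effect_struct_scheme \<Rightarrow> nat \<Rightarrow> 'a \<Rightarrow> 'a option" where
  "nmult E 0 a = Some (ezero E)"
| "nmult E (Suc 0) a = Some a"
| "nmult E (Suc (Suc n)) a = Option.bind (nmult E (Suc n) a) (\<lambda>b. b \<boxplus>\<^bsub>E\<^esub> a)"

definition isotropic_index :: "('a, 'm) effect_struct_scheme \<Rightarrow> 'a \<Rightarrow> enat" where
  "isotropic_index E a =
     (if \<forall>n. nmult E n a \<noteq> None then \<infinity> else enat (GREATEST n. nmult E n a \<noteq> None))"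

text \<open>The sum of a finite sequence, bracketed to the left. Starting the fold at zero is harmless,
  because zero is neutral in an effect algebra (\<open>zero_plus\<close> below).\<close>

definition list_esum :: "('a, 'm) effect_struct_scheme \<Rightarrow> 'a list \<Rightarrow> 'a option" where
  "list_esum E as = foldl (\<lambda>s a. Option.bind s (\<lambda>b. b \<boxplus>\<^bsub>E\<^esub> a)) (Some (ezero E)) as"

text \<open>An at most countable system of not necessarily different elements is a family \<open>x\<close> indexed
  by a set \<open>J\<close> of natural numbers. A finite subsystem is given by a finite \<open>F \<subseteq> J\<close>; listing \<open>F\<close>
  in increasing order is immaterial, since the operation is commutative and associative.\<close>

definition subsystem_esum ::
  "('a, 'm) effect_struct_scheme \<Rightarrow> (nat \<Rightarrow> 'a) \<Rightarrow> nat set \<Rightarrow> 'a option" where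
  "subsystem_esum E x F = list_esum E (map x (sorted_list_of_set F))"

definition orthogonal_system ::
  "('a, 'm) effect_struct_scheme \<Rightarrow> (nat \<Rightarrow> 'a) \<Rightarrow> nat set \<Rightarrow> bool" where
  "orthogonal_system E x J \<longleftrightarrow>
     x \<in> J \<rightarrow> carrier E \<and> (\<forall>F. finite F \<and> F \<subseteq> J \<longrightarrow> subsystem_esum E x F \<noteq> None)"

definition is_system_esum ::
  "('a, 'm) effect_struct_scheme \<Rightarrow> (nat \<Rightarrow> 'a) \<Rightarrow> nat set \<Rightarrow> 'a \<Rightarrow> bool" where
  "is_system_esum E x J b \<longleftrightarrow>
     least (effect_order E) b
       (Upper (effect_order E) {z. \<exists>F. finite F \<and> F \<subseteq> J \<and> subsystem_esum E x F = Some z})"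

definition sigma_orthocomplete :: "('a, 'm) effect_struct_scheme \<Rightarrow> bool" where
  "sigma_orthocomplete E \<longleftrightarrow>
     (\<forall>x J. orthogonal_system E x J \<longrightarrow> (\<exists>b. is_system_esum E x J b))"


section \<open>States\<close>

text \<open>Maps on the carrier are extensional functions, so that equality of states is equality
  of maps on the carrier.\<close>

definition estate :: "('a, 'm) effect_struct_scheme \<Rightarrow> ('a \<Rightarrow> real) \<Rightarrow> bool" where
  "estate E s \<longleftrightarrow> s \<in> carrier E \<rightarrow>\<^sub>E {0..1} \<and>
     (\<forall>a\<in>carrier E. \<forall>b\<in>carrier E. \<forall>c. a \<boxplus>\<^bsub>E\<^esub> b = Some c \<longrightarrow> s c = s a + s b) \<and>
     s (eone E) = 1"

definition extremal_estate :: "('a, 'm) effect_struct_scheme \<Rightarrow> ('a \<Rightarrow> real) \<Rightarrow> bool" where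
  "extremal_estate E s \<longleftrightarrow> estate E s \<and>
     (\<forall>s1 s2 \<alpha>. estate E s1 \<and> estate E s2 \<and> 0 < \<alpha> \<and> \<alpha> < 1 \<and>
        s = (\<lambda>a\<in>carrier E. \<alpha> * s1 a + (1 - \<alpha>) * s2 a) \<longrightarrow> s = s1 \<and> s = s2)"

definition sigma_additive :: "('a, 'm) effect_struct_scheme \<Rightarrow> ('a \<Rightarrow> real) \<Rightarrow> bool" where
  "sigma_additive E s \<longleftrightarrow>
     (\<forall>x a. (\<forall>n. x n \<in> carrier E) \<and> (\<forall>n. x n \<sqsubseteq>\<^bsub>effect_order E\<^esub> x (Suc n)) \<and>
        least (effect_order E) a (Upper (effect_order E) (range x)) \<longrightarrow>
        (\<lambda>n. s (x n)) \<longlonglongrightarrow> s a)"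

text \<open>\<open>full_multiple E a\<close> is \<open>\<imath>a\<close>, and \<open>atom_state E a\<close> is the map \<open>s\<^sub>i\<close> for \<open>a = a\<^sub>i\<close>. They are
  meaningful only if the isotropic index \<open>\<imath>\<close> of \<open>a\<close> is finite and, for \<open>atom_state\<close>, the
  meets with \<open>\<imath>a\<close> exist.\<close>

definition full_multiple :: "('a, 'm) effect_struct_scheme \<Rightarrow> 'a \<Rightarrow> 'a" where
  "full_multiple E a = the (nmult E (the_enat (isotropic_index E a)) a)"

definition atom_state :: "('a, 'm) effect_struct_scheme \<Rightarrow> 'a \<Rightarrow> 'a \<Rightarrow> real" where
  "atom_state E a = (\<lambda>x\<in>carrier E.
     real (Max {j. \<exists>y. nmult E j a = Some y \<and>
                       y \<sqsubseteq>\<^bsub>effect_order E\<^esub> (x \<sqinter>\<^bsub>effect_order E\<^esub> full_multiple E a)})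
     / real (the_enat (isotropic_index E a)))"


lemma (in effect_algebra) zero_plus:
  assumes a: "a \<in> carrier E"
  shows "ezero E \<boxplus> a = Some a"
proof -
  obtain z where z: "z \<in> carrier E" "eone E \<boxplus> z = Some (eone E)"
    using E3[OF one_closed] by blast
  then have "z = ezero E"
    using E1[OF one_closed] E4 by blast
  with z have one: "eone E \<boxplus> ezero E = Some (eone E)" by simp
  obtain b where b: "b \<in> carrier E" "a \<boxplus> b = Some (eone E)"
    using E3[OF a] by blast
  have ba: "b \<boxplus> a = Some (eone E)" using E1[OF a b] .
  obtain f where f: "a \<boxplus> ezero E = Some f" "b \<boxplus> f = Some (eone E)"
    using E2[OF b(1) a zero_closed ba one] by blast
  have "f \<in> carrier E" using plus_closed[OF a zero_closed f(1)] .
  then have "f = a" using E3[OF b(1)] a ba f(2) by blast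
  with f show ?thesis using E1[OF a zero_closed] by blast
qed

end

theory Submission
  imports Defs
begin

text \<open>
  Everything rests on the number \<open>m\<^sub>a(x)\<close> of copies of an atom \<open>a\<close> that fit below \<open>x\<close>. It is
  finite, because \<open>\<sigma>\<close>-orthocompleteness makes \<open>E\<close> Archimedean
  (\<open>sigma_orthocomplete_isotropic_index_finite\<close>). By RDP every element below a multiple of \<open>a\<close> is
  itself a multiple of \<open>a\<close> (\<open>below_multiple\<close>). It follows that the meet in the definition of
  \<open>atom_state\<close> is \<open>m\<^sub>a(x)a\<close>, and that \<open>m\<^sub>a\<close> is additive (\<open>multiplicity_plus\<close>); dividing by the
  isotropic index \<open>\<iota>\<^sub>a\<close> gives a state \<open>s\<^sub>a\<close>.

  For an arbitrary state \<open>s\<close>, monotonicity gives \<open>s(x) \<ge> m\<^sub>a(x) s(a) = s(\<iota>\<^sub>a a) s\<^sub>a(x)\<close>. Two states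
  that are comparable pointwise are equal, since the values at an element and at its complement
  add up to \<open>1\<close>. So \<open>s(\<iota>\<^sub>a a) = 1\<close> forces \<open>s = s\<^sub>a\<close> (\<open>estate_eq_atom_state_iff\<close>), and this
  makes \<open>s\<^sub>a\<close> extremal: both components of a convex decomposition must be \<open>1\<close> at \<open>\<iota>\<^sub>a a\<close>.
  The same inequality lets one split \<open>s\<^sub>a\<close> off from any state that is positive at \<open>\<iota>\<^sub>a a\<close>, so that
  an extremal such state is \<open>s\<^sub>a\<close> itself (\<open>extremal_eq_atom_state\<close>). The \<open>\<sigma>\<close>-additivity of
  \<open>s\<^sub>a\<close> holds because \<open>m\<^sub>a\<close> has integer values: if it stayed below \<open>m\<^sub>a(x)\<close> along an increasing
  sequence with supremum \<open>x\<close>, then \<open>x \<ominus> a\<close> would be a smaller upper bound.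

  Finally, in the atomic case each \<open>x\<close> is the sum of the system of all \<open>m\<^sub>a(x)a\<close>
  (\<open>atom_multiples_system_esum\<close>): the finite sums exist below \<open>x\<close>, and the difference of \<open>x\<close> and
  their supremum lies above no atom. A \<open>\<sigma>\<close>-additive state turns this into the series
  \<open>s(x) = \<Sum>\<^sub>a m\<^sub>a(x) s(a)\<close>. At the unit element the series shows that \<open>s\<close> is positive at some
  \<open>\<iota>\<^sub>a a\<close>, which reduces the classification of extremal \<open>\<sigma>\<close>-additive states to the splitting
  argument above.
\<close>

section \<open>Cancellation, order and multiples in effect algebras\<close>

context effect_algebra
begin

abbreviation leq (infix \<open>\<preceq>\<close> 50) where
  "x \<preceq> y \<equiv> x \<sqsubseteq>\<^bsub>effect_order E\<^esub> y"

lemma plus_comm: "a \<in> carrier E \<Longrightarrow> b \<in> carrier E \<Longrightarrow> a \<boxplus> b = b \<boxplus> a"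
  by (metis E1 not_None_eq)

lemma plus_zero: "a \<in> carrier E \<Longrightarrow> a \<boxplus> ezero E = Some a"
  using plus_comm zero_closed zero_plus by simp

lemma plus_assocE:
  assumes "a \<in> carrier E" "b \<in> carrier E" "c \<in> carrier E" "a \<boxplus> b = Some d" "d \<boxplus> c = Some e"
  obtains f where "f \<in> carrier E" "b \<boxplus> c = Some f" "a \<boxplus> f = Some e"
  using E2[OF assms] plus_closed assms(2,3) by blast

lemma plus_assoc_revE:
  assumes "a \<in> carrier E" "b \<in> carrier E" "c \<in> carrier E" "b \<boxplus> c = Some f" "a \<boxplus> f = Some e"
  obtains d where "d \<in> carrier E" "a \<boxplus> b = Some d" "d \<boxplus> c = Some e"
proof -
  have f: "f \<in> carrier E" using plus_closed assms by blast
  have "c \<boxplus> b = Some f" "f \<boxplus> a = Some e"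
    using assms f by (auto simp: plus_comm)
  then obtain d where d: "d \<in> carrier E" "b \<boxplus> a = Some d" "c \<boxplus> d = Some e"
    using plus_assocE[of c b a f e] assms by blast
  with assms show thesis by (intro that[of d]) (auto simp: plus_comm)
qed

text \<open>Adding the complement of the common sum to both sides exhibits both elements as complements
  of one and the same element, so uniqueness of complements yields cancellation.\<close>

lemma plus_cancel:
  assumes "a \<in> carrier E" "b \<in> carrier E" "c \<in> carrier E" "a \<boxplus> b = Some d" "a \<boxplus> c = Some d"
  shows "b = c"
proof -
  have d: "d \<in> carrier E" using plus_closed assms by blast
  then obtain d' where d': "d' \<in> carrier E" "d \<boxplus> d' = Some (eone E)" using E3 by blast
  have "b \<boxplus> a = Some d" "c \<boxplus> a = Some d" using assms by (auto simp: plus_comm)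
  then obtain f where f: "f \<in> carrier E" "a \<boxplus> d' = Some f" "b \<boxplus> f = Some (eone E)"
      "c \<boxplus> f = Some (eone E)"
    using plus_assocE[of b a d' d "eone E"] plus_assocE[of c a d' d "eone E"] assms d'
    by (metis option.inject)
  then have "f \<boxplus> b = Some (eone E)" "f \<boxplus> c = Some (eone E)"
    using assms by (auto simp: plus_comm)
  then show ?thesis using E3[OF f(1)] assms by blast
qed

lemma plus_eq_zero:
  assumes "a \<in> carrier E" "b \<in> carrier E" "a \<boxplus> b = Some (ezero E)"
  shows "b = ezero E"
proof -
  obtain f where "b \<boxplus> eone E = Some f"
    using plus_assocE[OF assms(1,2) one_closed assms(3) zero_plus[OF one_closed]] by blast
  then show ?thesis using E4 assms by blast
qed

lemma le_iff: "x \<in> carrier E \<Longrightarrow> x \<preceq> y \<longleftrightarrow> (\<exists>c\<in>carrier E. x \<boxplus> c = Some y)"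
  by (auto simp: effect_order_def plus_comm)

lemma leE:
  assumes "x \<preceq> y" "x \<in> carrier E"
  obtains c where "c \<in> carrier E" "x \<boxplus> c = Some y"
  using assms le_iff by blast

lemma plus_upper:
  assumes "x \<in> carrier E" "y \<in> carrier E" "x \<boxplus> y = Some z"
  shows "x \<preceq> z" "y \<preceq> z"
  using assms le_iff[of x z] le_iff[of y z] plus_comm[of x y] by auto

lemma le_closed: "x \<in> carrier E \<Longrightarrow> x \<preceq> y \<Longrightarrow> y \<in> carrier E"
  using le_iff plus_closed by blast

lemma le_refl: "x \<in> carrier E \<Longrightarrow> x \<preceq> x"
  using le_iff plus_zero zero_closed by blast

lemma zero_le: "x \<in> carrier E \<Longrightarrow> ezero E \<preceq> x"
  using le_iff zero_plus zero_closed by blast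

lemma le_one: "x \<in> carrier E \<Longrightarrow> x \<preceq> eone E"
  using le_iff E3 by blast

lemma le_trans:
  assumes "x \<in> carrier E" "x \<preceq> y" "y \<preceq> z"
  shows "x \<preceq> z"
proof -
  obtain c where c: "c \<in> carrier E" "x \<boxplus> c = Some y" using assms leE by blast
  obtain d where d: "d \<in> carrier E" "y \<boxplus> d = Some z"
    using assms le_closed leE by blast
  show ?thesis
    using plus_assocE[OF assms(1) c(1) d(1) c(2) d(2)] le_iff assms(1) by blast
qed

lemma plus_eq_self: "x \<in> carrier E \<Longrightarrow> c \<in> carrier E \<Longrightarrow> x \<boxplus> c = Some x \<Longrightarrow> c = ezero E"
  using plus_cancel plus_zero zero_closed by blast

lemma le_antisym:
  assumes "x \<in> carrier E" "x \<preceq> y" "y \<preceq> x"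
  shows "x = y"
proof -
  obtain c where c: "c \<in> carrier E" "x \<boxplus> c = Some y" using assms leE by blast
  obtain d where d: "d \<in> carrier E" "y \<boxplus> d = Some x"
    using assms le_closed leE by blast
  obtain f where "f \<in> carrier E" "c \<boxplus> d = Some f" "x \<boxplus> f = Some x"
    using plus_assocE[OF assms(1) c(1) d(1) c(2) d(2)] by blast
  then have "d = ezero E" using plus_eq_self plus_eq_zero assms c d by blast
  then show ?thesis using d plus_zero le_closed assms by (metis option.inject)
qed

text \<open>In terms of differences: \<open>a \<preceq> y \<ominus> x\<close> implies \<open>x \<preceq> y \<ominus> a\<close>.\<close>

lemma le_difference_swap:
  assumes "x \<in> carrier E" "c \<in> carrier E" "a \<in> carrier E" "d \<in> carrier E"
    and "x \<boxplus> c = Some y" "a \<boxplus> d = Some y" "a \<preceq> c"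
  shows "x \<preceq> d"
proof -
  obtain e where e: "e \<in> carrier E" "a \<boxplus> e = Some c" using assms leE by blast
  then obtain w where w: "w \<in> carrier E" "x \<boxplus> a = Some w" "w \<boxplus> e = Some y"
    using plus_assoc_revE[of x a e c y] assms by blast
  then have "a \<boxplus> x = Some w" using assms plus_comm by simp
  then obtain f where f: "f \<in> carrier E" "x \<boxplus> e = Some f" "a \<boxplus> f = Some y"
    using plus_assocE[of a x e w y] assms e w by blast
  then have "f = d" using plus_cancel assms by blast
  then show ?thesis using f e assms le_iff by blast
qed

lemma nmult_Suc:
  "a \<in> carrier E \<Longrightarrow> nmult E (Suc n) a = Option.bind (nmult E n a) (\<lambda>b. b \<boxplus> a)"
  by (cases n) (auto simp: zero_plus)

lemma nmult_closed: "a \<in> carrier E \<Longrightarrow> nmult E n a = Some y \<Longrightarrow> y \<in> carrier E"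
proof (induction n arbitrary: y)
  case (Suc n)
  then show ?case by (auto simp: nmult_Suc bind_eq_Some_conv simp del: nmult.simps(3) intro: plus_closed)
qed (auto simp: zero_closed)

lemma nmult_add_split:
  "a \<in> carrier E \<Longrightarrow> nmult E (m + n) a = Some z \<Longrightarrow>
   \<exists>u v. nmult E m a = Some u \<and> nmult E n a = Some v \<and> u \<boxplus> v = Some z"
proof (induction n arbitrary: z)
  case 0
  then show ?case using plus_zero nmult_closed by auto
next
  case (Suc n)
  then obtain w where w: "nmult E (m + n) a = Some w" "w \<boxplus> a = Some z"
    by (auto simp: nmult_Suc bind_eq_Some_conv)
  then obtain u v where uv: "nmult E m a = Some u" "nmult E n a = Some v" "u \<boxplus> v = Some w"
    using Suc by blast
  then obtain f where "v \<boxplus> a = Some f" "u \<boxplus> f = Some z"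
    using plus_assocE[of u v a w z] w nmult_closed Suc.prems(1) by metis
  then show ?case using uv Suc.prems by (auto simp: nmult_Suc)
qed

lemma nmult_add:
  "a \<in> carrier E \<Longrightarrow> nmult E m a = Some u \<Longrightarrow> nmult E n a = Some v \<Longrightarrow> u \<boxplus> v = Some z
   \<Longrightarrow> nmult E (m + n) a = Some z"
proof (induction n arbitrary: v z)
  case 0
  then show ?case using plus_zero nmult_closed by auto
next
  case (Suc n)
  then obtain w where w: "nmult E n a = Some w" "w \<boxplus> a = Some v"
    by (auto simp: nmult_Suc bind_eq_Some_conv)
  then obtain d where "u \<boxplus> w = Some d" "d \<boxplus> a = Some z"
    using plus_assoc_revE[of u w a v z] nmult_closed Suc.prems by metis
  then show ?case using Suc.IH[of w d] w Suc.prems by (auto simp: nmult_Suc)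
qed

lemma nmult_mono:
  assumes "a \<in> carrier E" "nmult E n a = Some y" "m \<le> n"
  obtains u where "nmult E m a = Some u" "u \<preceq> y"
proof -
  obtain u v where "nmult E m a = Some u" "nmult E (n - m) a = Some v" "u \<boxplus> v = Some y"
    using nmult_add_split[of a m "n - m" y] assms by auto
  then show thesis using that plus_upper nmult_closed assms(1) by metis
qed

lemma nmult_eq_zero:
  assumes "a \<in> carrier E" "a \<noteq> ezero E" "nmult E n a = Some (ezero E)"
  shows "n = 0"
proof (cases n)
  case (Suc k)
  then obtain w where "nmult E k a = Some w" "w \<boxplus> a = Some (ezero E)"
    using assms by (auto simp: nmult_Suc bind_eq_Some_conv)
  then show ?thesis using plus_eq_zero nmult_closed assms by blast
qed

lemma nmult_inj:
  assumes "a \<in> carrier E" "a \<noteq> ezero E" "nmult E m a = Some y" "nmult E n a = Some y"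
  shows "m = n"
proof -
  have "k = 0" if k: "nmult E i a = Some y" "nmult E (i + k) a = Some y" for i k
  proof -
    obtain v where "nmult E k a = Some v" "y \<boxplus> v = Some y"
      using nmult_add_split[of a i k y] k assms by auto
    then show ?thesis using plus_eq_self nmult_closed nmult_eq_zero assms by metis
  qed
  from this[of m "n - m"] this[of n "m - n"] show ?thesis
    using assms by (cases "m \<le> n") auto
qed

lemma list_esum_Nil: "list_esum E [] = Some (ezero E)"
  by (simp add: list_esum_def)

lemma list_esum_snoc: "list_esum E (xs @ [x]) = Option.bind (list_esum E xs) (\<lambda>b. b \<boxplus> x)"
  by (simp add: list_esum_def)

lemma list_esum_closed:
  "set xs \<subseteq> carrier E \<Longrightarrow> list_esum E xs = Some z \<Longrightarrow> z \<in> carrier E"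
proof (induction xs arbitrary: z rule: rev_induct)
  case (snoc x xs)
  then show ?case by (auto simp: list_esum_snoc bind_eq_Some_conv intro: plus_closed)
qed (auto simp: list_esum_Nil zero_closed)

lemma list_esum_additive:
  fixes f :: "'a \<Rightarrow> 'n::comm_monoid_add"
  assumes add: "\<And>a b c. a \<in> carrier E \<Longrightarrow> b \<in> carrier E \<Longrightarrow> a \<boxplus> b = Some c \<Longrightarrow> f c = f a + f b"
    and zero: "f (ezero E) = 0"
  shows "set xs \<subseteq> carrier E \<Longrightarrow> list_esum E xs = Some z \<Longrightarrow> f z = sum_list (map f xs)"
proof (induction xs arbitrary: z rule: rev_induct)
  case (snoc x xs)
  then obtain w where w: "list_esum E xs = Some w" "w \<boxplus> x = Some z"
    by (auto simp: list_esum_snoc bind_eq_Some_conv)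
  then have "f z = f w + f x" using snoc.prems list_esum_closed by (intro add) auto
  then show ?case using snoc.IH[OF _ w(1)] snoc.prems by simp
qed (auto simp: list_esum_Nil zero)

lemma member_le_list_esum:
  "set xs \<subseteq> carrier E \<Longrightarrow> list_esum E xs = Some z \<Longrightarrow> x \<in> set xs \<Longrightarrow> x \<preceq> z"
proof (induction xs arbitrary: z rule: rev_induct)
  case (snoc y xs)
  then obtain w where w: "list_esum E xs = Some w" "w \<boxplus> y = Some z"
    by (auto simp: list_esum_snoc bind_eq_Some_conv)
  then have "w \<in> carrier E" using snoc.prems list_esum_closed by auto
  then have "w \<preceq> z" "y \<preceq> z" using plus_upper[of w y z] w snoc.prems by auto
  then show ?case using snoc.IH[OF _ w(1)] snoc.prems le_trans[of x w z] by auto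
qed simp

lemma list_esum_replicate: "a \<in> carrier E \<Longrightarrow> list_esum E (replicate n a) = nmult E n a"
proof (induction n)
  case (Suc n)
  have "replicate (Suc n) a = replicate n a @ [a]" by (simp add: replicate_append_same)
  then show ?case using Suc by (simp add: list_esum_snoc nmult_Suc del: replicate_Suc nmult.simps(3))
qed (simp add: list_esum_Nil)

lemma carrier_effect_order: "carrier (effect_order E) = carrier E"
  by (simp add: effect_order_def)

lemma least_upper_iff:
  assumes "A \<subseteq> carrier E"
  shows "least (effect_order E) b (Upper (effect_order E) A) \<longleftrightarrow>
    b \<in> carrier E \<and> (\<forall>x\<in>A. x \<preceq> b) \<and>
    (\<forall>u\<in>carrier E. (\<forall>x\<in>A. x \<preceq> u) \<longrightarrow> b \<preceq> u)"
proof -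
  have "Upper (effect_order E) A = {u \<in> carrier E. \<forall>x\<in>A. x \<preceq> u}"
    using assms unfolding Upper_def carrier_effect_order by blast
  then show ?thesis by (auto simp: least_def carrier_effect_order)
qed

text \<open>If all multiples of \<open>a\<close> existed, they would form an orthogonal system. Its sum \<open>b\<close> would
  be the supremum of the multiples, but \<open>b \<ominus> a\<close> dominates every multiple as well; hence \<open>a\<close> is zero.\<close>

lemma sigma_orthocomplete_isotropic_index_finite:
  assumes soc: "sigma_orthocomplete E" and a: "a \<in> carrier E" "a \<noteq> ezero E"
  shows "isotropic_index E a \<noteq> \<infinity>"
proof
  assume "isotropic_index E a = \<infinity>"
  then have all: "nmult E n a \<noteq> None" for n
    by (auto simp: isotropic_index_def split: if_splits)
  have sub: "subsystem_esum E (\<lambda>_. a) F = nmult E (card F) a" for F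
    using list_esum_replicate[OF a(1)] by (simp add: subsystem_esum_def map_replicate_const)
  have "orthogonal_system E (\<lambda>_. a) UNIV"
    using all sub a by (auto simp: orthogonal_system_def)
  then obtain b where b: "is_system_esum E (\<lambda>_. a) UNIV b"
    using soc unfolding sigma_orthocomplete_def by blast
  let ?S = "{z. \<exists>F::nat set. finite F \<and> F \<subseteq> UNIV \<and> subsystem_esum E (\<lambda>_. a) F = Some z}"
  have S: "?S \<subseteq> carrier E" using sub nmult_closed[OF a(1)] by auto
  have mem: "z \<in> ?S" if "nmult E n a = Some z" for n z
    using that sub[of "{..<n}"] by auto
  have bc: "b \<in> carrier E" and ub: "\<And>z. z \<in> ?S \<Longrightarrow> z \<preceq> b"
    and lb: "\<And>u. u \<in> carrier E \<Longrightarrow> (\<And>z. z \<in> ?S \<Longrightarrow> z \<preceq> u) \<Longrightarrow> b \<preceq> u"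
    using b S unfolding is_system_esum_def by (auto simp: least_upper_iff)
  have "a \<preceq> b" using ub mem[of 1 a] by simp
  then obtain d where d: "d \<in> carrier E" "a \<boxplus> d = Some b" using leE a by blast
  have "z \<preceq> d" if z: "z \<in> ?S" for z
  proof -
    obtain n where n: "nmult E n a = Some z" using z sub by auto
    obtain w where w: "nmult E (Suc n) a = Some w" using all by (meson not_None_eq)
    then have zw: "z \<boxplus> a = Some w" using n a by (simp add: nmult_Suc del: nmult.simps(3))
    have wc: "w \<in> carrier E" "w \<preceq> b" using nmult_closed[OF a(1) w] ub[OF mem[OF w]] by auto
    then obtain e where e: "e \<in> carrier E" "w \<boxplus> e = Some b" using leE by blast
    then obtain f where "f \<in> carrier E" "a \<boxplus> e = Some f" "z \<boxplus> f = Some b"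
      using plus_assocE[of z a e w b] zw z S a by blast
    then show ?thesis
      using le_difference_swap[of z f a d b] z S a d plus_upper[of a e f] e by blast
  qed
  then have "b \<preceq> d" using lb d by blast
  moreover have "d \<preceq> b" using plus_upper a d by blast
  ultimately have "d = b" using le_antisym d by blast
  then show False using plus_eq_self[of d a] d a plus_comm by simp
qed

end

section \<open>Multiplicities of atoms\<close>

locale archimedean_rdp_effect_algebra = effect_algebra +
  assumes rdp: "RDP E"
    and archimedean: "\<lbrakk>a \<in> carrier E; a \<noteq> ezero E\<rbrakk> \<Longrightarrow> isotropic_index E a \<noteq> \<infinity>"
begin

lemma le_plus_split:
  assumes "x \<in> carrier E" "y \<in> carrier E" "z \<in> carrier E" "y \<boxplus> z = Some w" "x \<preceq> w"
  obtains u v where "u \<in> carrier E" "v \<in> carrier E" "u \<boxplus> v = Some x" "u \<preceq> y" "v \<preceq> z"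
proof -
  obtain c where "c \<in> carrier E" "x \<boxplus> c = Some w" using assms leE by blast
  then obtain u v p q where "u \<in> carrier E" "v \<in> carrier E" "p \<in> carrier E" "q \<in> carrier E"
      "u \<boxplus> v = Some x" "p \<boxplus> q = Some c" "u \<boxplus> p = Some y" "v \<boxplus> q = Some z"
    using rdp[unfolded RDP_def, rule_format, of x c y z w] assms by blast
  then show thesis using that plus_upper by blast
qed

lemma atom_closed: "a \<in> eatoms E \<Longrightarrow> a \<in> carrier E"
  and atom_nonzero: "a \<in> eatoms E \<Longrightarrow> a \<noteq> ezero E"
  by (auto simp: eatoms_def)

lemma below_atom: "a \<in> eatoms E \<Longrightarrow> x \<in> carrier E \<Longrightarrow> x \<preceq> a \<Longrightarrow> x = ezero E \<or> x = a"
  using zero_le unfolding eatoms_def by blast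

text \<open>An element below a sum of copies of an atom splits by RDP into parts of the single
  copies, and each part is trivial.\<close>

lemma below_multiple:
  assumes a: "a \<in> eatoms E"
  shows "nmult E n a = Some y \<Longrightarrow> x \<in> carrier E \<Longrightarrow> x \<preceq> y \<Longrightarrow> \<exists>k\<le>n. nmult E k a = Some x"
proof (induction n arbitrary: x y)
  case 0
  then have "x = ezero E" using zero_le le_antisym by simp
  then show ?case by simp
next
  case (Suc n)
  obtain w where w: "nmult E n a = Some w" "w \<boxplus> a = Some y"
    using Suc.prems a atom_closed by (auto simp: nmult_Suc bind_eq_Some_conv)
  have wc: "w \<in> carrier E" using w nmult_closed a atom_closed by blast
  obtain u v where uv: "u \<in> carrier E" "v \<in> carrier E" "u \<boxplus> v = Some x" "u \<preceq> w" "v \<preceq> a"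
    using le_plus_split[of x w a y] Suc.prems wc w a atom_closed by blast
  obtain k where k: "k \<le> n" "nmult E k a = Some u" using Suc.IH w uv by blast
  from below_atom[OF a] uv have "v = ezero E \<or> v = a" by blast
  then show ?case
  proof
    assume "v = ezero E"
    then have "u = x" using uv(3) plus_zero[OF uv(1)] by simp
    then show ?thesis using k by (intro exI[of _ k]) simp
  next
    assume "v = a"
    then have "nmult E (Suc k) a = Some x"
      using k(2) uv(3) nmult_Suc[OF atom_closed[OF a], of k] by simp
    then show ?thesis using k(1) by (intro exI[of _ "Suc k"]) (simp del: nmult.simps)
  qed
qed

text \<open>This is the numerator of \<open>atom_state\<close> without the meet with the full multiple: multiples of \<open>a\<close>
  lie below that full multiple anyway.\<close>

definition multiplicity :: "'a \<Rightarrow> 'a \<Rightarrow> nat" where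
  "multiplicity a x = Max {j. \<exists>y. nmult E j a = Some y \<and> y \<preceq> x}"

definition index :: "'a \<Rightarrow> nat" where
  "index a = the_enat (isotropic_index E a)"

lemma finite_multiples:
  assumes "a \<in> carrier E" "a \<noteq> ezero E"
  shows "finite {j. nmult E j a \<noteq> None}"
proof -
  obtain n where n: "nmult E n a = None"
    using archimedean[OF assms] unfolding isotropic_index_def by meson
  have "{j. nmult E j a \<noteq> None} \<subseteq> {..<n}"
  proof
    fix j assume "j \<in> {j. nmult E j a \<noteq> None}"
    then show "j \<in> {..<n}" using nmult_mono[of a j _ n] n assms by force
  qed
  then show ?thesis using finite_subset by blast
qed

lemma index_props:
  assumes a: "a \<in> carrier E" "a \<noteq> ezero E"
  shows nmult_index: "nmult E (index a) a = Some (full_multiple E a)"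
    and le_index: "nmult E j a = Some y \<Longrightarrow> j \<le> index a"
    and index_pos: "0 < index a"
    and full_closed: "full_multiple E a \<in> carrier E"
proof -
  have ex: "\<not> (\<forall>n. nmult E n a \<noteq> None)"
    using archimedean[OF a] unfolding isotropic_index_def by meson
  have index: "index a = (GREATEST n. nmult E n a \<noteq> None)"
    using ex unfolding index_def isotropic_index_def by (simp only: if_False the_enat.simps)
  obtain b where b: "\<And>j. nmult E j a \<noteq> None \<Longrightarrow> j \<le> b"
    using finite_multiples[OF a] by (auto simp: finite_nat_set_iff_bounded_le)
  have "nmult E (index a) a \<noteq> None" unfolding index
    by (rule GreatestI_nat[of _ 0 b]) (use b in auto)
  then show full: "nmult E (index a) a = Some (full_multiple E a)"
    by (auto simp: full_multiple_def index_def)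
  then show "full_multiple E a \<in> carrier E" using nmult_closed a by blast
  show le: "j \<le> index a" if "nmult E j a = Some y" for j y
    unfolding index by (rule Greatest_le_nat[of _ _ b]) (use b that in auto)
  show "0 < index a" using le[of 1 a] by simp
qed

context
  fixes a assumes atom: "a \<in> eatoms E"
begin

lemmas a_closed = atom_closed[OF atom]
lemmas a_nonzero = atom_nonzero[OF atom]

lemma finite_multiples_below: "finite {j. \<exists>y. nmult E j a = Some y \<and> y \<preceq> x}"
  by (rule finite_subset[OF _ finite_multiples[OF a_closed a_nonzero]]) auto

lemma multiplicity_multiple:
  assumes "x \<in> carrier E"
  obtains y where "y \<in> carrier E" "nmult E (multiplicity a x) a = Some y" "y \<preceq> x"
proof -
  have "0 \<in> {j. \<exists>y. nmult E j a = Some y \<and> y \<preceq> x}"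
    using zero_le[OF assms] nmult.simps(1)[of E a] by blast
  then have "multiplicity a x \<in> {j. \<exists>y. nmult E j a = Some y \<and> y \<preceq> x}"
    unfolding multiplicity_def by (intro Max_in finite_multiples_below) blast
  then show thesis using that nmult_closed a_closed by auto
qed

lemma le_multiplicity_iff:
  assumes "x \<in> carrier E" "nmult E j a = Some y"
  shows "y \<preceq> x \<longleftrightarrow> j \<le> multiplicity a x"
proof
  assume "y \<preceq> x"
  then show "j \<le> multiplicity a x"
    unfolding multiplicity_def using assms by (intro Max_ge finite_multiples_below) blast
next
  assume j: "j \<le> multiplicity a x"
  obtain z where z: "z \<in> carrier E" "nmult E (multiplicity a x) a = Some z" "z \<preceq> x"
    using multiplicity_multiple assms by blast
  obtain u where "nmult E j a = Some u" "u \<preceq> z"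
    using nmult_mono[OF a_closed z(2) j] by blast
  then show "y \<preceq> x" using assms z le_trans[of y z x] nmult_closed a_closed by auto
qed

lemma atom_le_iff: "x \<in> carrier E \<Longrightarrow> a \<preceq> x \<longleftrightarrow> 1 \<le> multiplicity a x"
  using le_multiplicity_iff[of x 1 a] by simp

lemma multiplicity_nmult:
  assumes "nmult E j a = Some y"
  shows "multiplicity a y = j"
proof -
  have y: "y \<in> carrier E" using assms nmult_closed a_closed by blast
  have ge: "j \<le> multiplicity a y" using le_multiplicity_iff[OF y assms] le_refl[OF y] by simp
  obtain z where z: "z \<in> carrier E" "nmult E (multiplicity a y) a = Some z" "z \<preceq> y"
    using multiplicity_multiple[OF y] by blast
  have "y \<preceq> z" using nmult_mono[OF a_closed z(2) ge] assms by auto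
  then have "z = y" using z le_antisym by blast
  then show ?thesis using nmult_inj a_closed a_nonzero z assms by blast
qed

lemma multiplicity_zero: "multiplicity a (ezero E) = 0"
  using multiplicity_nmult[of 0] by simp

lemma multiplicity_one: "multiplicity a (eone E) = index a"
proof (rule antisym)
  show "multiplicity a (eone E) \<le> index a"
    using multiplicity_multiple[OF one_closed] le_index[OF a_closed a_nonzero] by blast
  show "index a \<le> multiplicity a (eone E)"
    using le_multiplicity_iff[OF one_closed nmult_index[OF a_closed a_nonzero]]
      le_one full_closed[OF a_closed a_nonzero] by blast
qed

text \<open>Subadditivity is where RDP enters: it distributes the largest multiple of \<open>a\<close> below the sum
  over the two summands, and the two parts are again multiples of \<open>a\<close>.\<close>

lemma multiplicity_plus:
  assumes xy: "x \<in> carrier E" "y \<in> carrier E" "x \<boxplus> y = Some z"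
  shows "multiplicity a z = multiplicity a x + multiplicity a y"
proof (rule antisym)
  have z: "z \<in> carrier E" using assms plus_closed by blast
  obtain w where w: "w \<in> carrier E" "nmult E (multiplicity a z) a = Some w" "w \<preceq> z"
    using multiplicity_multiple[OF z] by blast
  obtain u v where uv: "u \<in> carrier E" "v \<in> carrier E" "u \<boxplus> v = Some w" "u \<preceq> x" "v \<preceq> y"
    using le_plus_split[of w x y z] w xy by blast
  have "u \<preceq> w" "v \<preceq> w" using plus_upper uv by blast+
  then obtain j k where jk: "nmult E j a = Some u" "nmult E k a = Some v"
    using below_multiple[OF atom w(2)] uv by blast
  then have "nmult E (j + k) a = Some w" using nmult_add a_closed uv by blast
  then have "multiplicity a z = j + k" using nmult_inj a_closed a_nonzero w by blast
  moreover have "j \<le> multiplicity a x" "k \<le> multiplicity a y"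
    using le_multiplicity_iff[OF xy(1) jk(1)] le_multiplicity_iff[OF xy(2) jk(2)] uv by auto
  ultimately show "multiplicity a z \<le> multiplicity a x + multiplicity a y" by simp
next
  have z: "z \<in> carrier E" using assms plus_closed by blast
  obtain u where u: "u \<in> carrier E" "nmult E (multiplicity a x) a = Some u" "u \<preceq> x"
    using multiplicity_multiple[OF xy(1)] by blast
  obtain v where v: "v \<in> carrier E" "nmult E (multiplicity a y) a = Some v" "v \<preceq> y"
    using multiplicity_multiple[OF xy(2)] by blast
  obtain p where p: "p \<in> carrier E" "u \<boxplus> p = Some x" using u leE by blast
  obtain q where q: "q \<in> carrier E" "v \<boxplus> q = Some y" using v leE by blast
  obtain t where t: "t \<in> carrier E" "x \<boxplus> v = Some t" "t \<boxplus> q = Some z"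
    using plus_assoc_revE[of x v q y z] xy v q by blast
  have "p \<boxplus> u = Some x" using p u plus_comm by simp
  then obtain f where f: "f \<in> carrier E" "u \<boxplus> v = Some f" "p \<boxplus> f = Some t"
    using plus_assocE[of p u v x t] p u v t by blast
  have "nmult E (multiplicity a x + multiplicity a y) a = Some f"
    using nmult_add a_closed u v f by blast
  moreover have "f \<preceq> z"
    using plus_upper(2)[OF p(1) f(1) f(3)] plus_upper(1)[OF t(1) q(1) t(3)] le_trans f by blast
  ultimately show "multiplicity a x + multiplicity a y \<le> multiplicity a z"
    using le_multiplicity_iff[OF z] by blast
qed

lemma multiplicity_other_atom:
  assumes b: "b \<in> eatoms E" "b \<noteq> a"
  shows "nmult E j b = Some y \<Longrightarrow> multiplicity a y = 0"
proof (induction j arbitrary: y)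
  case 0
  then show ?case using multiplicity_zero by simp
next
  case (Suc j)
  then obtain w where w: "nmult E j b = Some w" "w \<boxplus> b = Some y"
    using b atom_closed by (auto simp: nmult_Suc bind_eq_Some_conv)
  have "\<not> a \<preceq> b" using below_atom[OF b(1) a_closed] a_nonzero b by auto
  then have "multiplicity a b = 0" using atom_le_iff[of b] b atom_closed by simp
  then show ?case
    using multiplicity_plus[of w b y] w Suc.IH nmult_closed atom_closed b by simp
qed

text \<open>The meet with the full multiple of \<open>a\<close> exists by RDP: all elements below the full multiple are
  multiples of \<open>a\<close>, so the largest multiple of \<open>a\<close> below \<open>x\<close> is the greatest common lower bound.\<close>

lemma atom_state_eq:
  assumes x: "x \<in> carrier E"
  shows "atom_state E a x = real (multiplicity a x) / real (index a)"
proof -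
  let ?L = "effect_order E" and ?f = "full_multiple E a"
  note f = nmult_index[OF a_closed a_nonzero] full_closed[OF a_closed a_nonzero]
  obtain m where m: "m \<in> carrier E" "nmult E (multiplicity a x) a = Some m" "m \<preceq> x"
    using multiplicity_multiple[OF x] by blast
  have "multiplicity a x \<le> index a" using le_index[OF a_closed a_nonzero] m by blast
  then have mf: "m \<preceq> ?f" using nmult_mono[OF a_closed f(1)] m by (metis option.inject)
  have lower: "u \<preceq> m" if u: "u \<in> carrier E" "u \<preceq> x" "u \<preceq> ?f" for u
  proof -
    obtain k where k: "nmult E k a = Some u" using below_multiple[OF atom f(1)] u by blast
    then have "k \<le> multiplicity a x" using le_multiplicity_iff[OF x] u by blast
    then show ?thesis using nmult_mono[OF a_closed m(2)] k by (metis option.inject)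
  qed
  have great: "greatest ?L m (Lower ?L {x, ?f})"
    unfolding greatest_def Lower_def carrier_effect_order using m mf x f lower by auto
  have uniq: "y = m" if "greatest ?L y (Lower ?L {x, ?f})" for y
  proof (rule le_antisym)
    show "y \<in> carrier E" using that unfolding greatest_def Lower_def carrier_effect_order by auto
    show "y \<preceq> m" "m \<preceq> y" using that great unfolding greatest_def by auto
  qed
  have "x \<sqinter>\<^bsub>?L\<^esub> ?f = m"
    unfolding meet_def inf_def using great uniq by (rule some_equality)
  then have "{j. \<exists>y. nmult E j a = Some y \<and> y \<preceq> x \<sqinter>\<^bsub>?L\<^esub> ?f}
      = {j. \<exists>y. nmult E j a = Some y \<and> y \<preceq> x}"
    using m x le_multiplicity_iff multiplicity_nmult[OF m(2)] by auto
  then show ?thesis using x by (simp add: atom_state_def multiplicity_def index_def)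
qed

end

end

section \<open>The states given by atoms\<close>

context effect_algebra
begin

lemma estateD:
  assumes "estate E s"
  shows estate_plus: "a \<in> carrier E \<Longrightarrow> b \<in> carrier E \<Longrightarrow> a \<boxplus> b = Some c \<Longrightarrow> s c = s a + s b"
    and estate_nonneg: "a \<in> carrier E \<Longrightarrow> 0 \<le> s a"
    and estate_one: "s (eone E) = 1"
    and estate_ext: "s \<in> extensional (carrier E)"
  using assms unfolding estate_def by (auto simp: PiE_def Pi_def)

lemma estate_zero: "estate E s \<Longrightarrow> s (ezero E) = 0"
  using estate_plus[of s "ezero E" "ezero E" "ezero E"] zero_closed zero_plus by simp

lemma estate_mono:
  assumes "estate E s" "x \<in> carrier E" "x \<preceq> y"
  shows "s x \<le> s y"
proof -
  obtain c where "c \<in> carrier E" "x \<boxplus> c = Some y" using assms leE by blast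
  then show ?thesis using estate_plus[of s x c y] estate_nonneg[of s c] assms by simp
qed

lemma estate_nmult:
  assumes "estate E s" "a \<in> carrier E"
  shows "nmult E n a = Some y \<Longrightarrow> s y = real n * s a"
proof (induction n arbitrary: y)
  case 0
  then show ?case using estate_zero assms by simp
next
  case (Suc n)
  then obtain w where w: "nmult E n a = Some w" "w \<boxplus> a = Some y"
    using assms by (auto simp: nmult_Suc bind_eq_Some_conv)
  then have "s y = s w + s a" using estate_plus assms nmult_closed by blast
  then show ?case using Suc.IH[OF w(1)] by (simp add: algebra_simps)
qed

text \<open>The upper bound \<open>1\<close> comes for free, since the values at \<open>x\<close> and at its complement add up
  to \<open>1\<close>.\<close>

lemma estateI:
  assumes "s \<in> extensional (carrier E)" "s (eone E) = 1"
    and nonneg: "\<And>x. x \<in> carrier E \<Longrightarrow> 0 \<le> s x"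
    and add: "\<And>a b c. a \<in> carrier E \<Longrightarrow> b \<in> carrier E \<Longrightarrow> a \<boxplus> b = Some c \<Longrightarrow> s c = s a + s b"
  shows "estate E s"
proof -
  have "s x \<le> 1" if x: "x \<in> carrier E" for x
  proof -
    obtain y where "y \<in> carrier E" "x \<boxplus> y = Some (eone E)" using E3 x by blast
    then show ?thesis using add[of x y "eone E"] nonneg[of y] x assms(2) by simp
  qed
  then show ?thesis using assms unfolding estate_def by (auto simp: PiE_def)
qed

text \<open>The values at an element and at its complement add up to \<open>1\<close> for both states, so neither
  inequality can be strict.\<close>

lemma estate_eqI_le:
  assumes s: "estate E s" and t: "estate E t"
    and le: "\<And>x. x \<in> carrier E \<Longrightarrow> s x \<le> t x"
  shows "s = t"
proof (rule extensionalityI[OF estate_ext[OF s] estate_ext[OF t]])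
  fix x assume x: "x \<in> carrier E"
  obtain y where y: "y \<in> carrier E" "x \<boxplus> y = Some (eone E)" using E3 x by blast
  have "s x + s y = 1" "t x + t y = 1"
    using estate_plus[OF s x y] estate_plus[OF t x y] estate_one[OF s] estate_one[OF t] by auto
  then show "s x = t x" using le[OF x] le[OF y(1)] by simp
qed

end

context archimedean_rdp_effect_algebra
begin

context
  fixes a assumes atom: "a \<in> eatoms E"
begin

lemma estate_atom_state: "estate E (atom_state E a)"
proof (rule estateI)
  have "0 < index a" using index_pos atom_closed atom_nonzero atom by blast
  then show "atom_state E a (eone E) = 1"
    using atom_state_eq[OF atom one_closed] multiplicity_one[OF atom] by simp
next
  fix x y z assume xyz: "x \<in> carrier E" "y \<in> carrier E" "x \<boxplus> y = Some z"
  then have "z \<in> carrier E" using plus_closed by blast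
  then show "atom_state E a z = atom_state E a x + atom_state E a y"
    using xyz multiplicity_plus[OF atom] by (simp add: atom_state_eq[OF atom] add_divide_distrib)
qed (auto simp: atom_state_eq[OF atom] atom_state_def)

lemma estate_full_multiple:
  assumes "estate E s"
  shows "s (full_multiple E a) = real (index a) * s a"
  using estate_nmult assms nmult_index atom_closed[OF atom] atom_nonzero[OF atom] by blast

lemma scaled_atom_state:
  assumes s: "estate E s" and x: "x \<in> carrier E"
    and y: "nmult E (multiplicity a x) a = Some y"
  shows "s (full_multiple E a) * atom_state E a x = s y"
proof -
  have "0 < index a" using index_pos atom_closed atom_nonzero atom by blast
  then show ?thesis
    using estate_nmult[OF s atom_closed[OF atom] y] estate_full_multiple[OF s]
      atom_state_eq[OF atom x] by simp
qed

lemma scaled_atom_state_le: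
  assumes s: "estate E s" and x: "x \<in> carrier E"
  shows "s (full_multiple E a) * atom_state E a x \<le> s x"
proof -
  obtain y where "y \<in> carrier E" "nmult E (multiplicity a x) a = Some y" "y \<preceq> x"
    using multiplicity_multiple[OF atom x] by blast
  then show ?thesis using scaled_atom_state[OF s x] estate_mono[OF s] by metis
qed

lemma atom_state_full_multiple: "atom_state E a (full_multiple E a) = 1"
proof -
  note a = atom_closed[OF atom] atom_nonzero[OF atom]
  have "multiplicity a (full_multiple E a) = index a"
    using multiplicity_nmult[OF atom nmult_index[OF a]] .
  then show ?thesis using atom_state_eq[OF atom full_closed[OF a]] index_pos[OF a] by simp
qed

lemma atom_state_full_multiple_other:
  assumes "b \<in> eatoms E" "b \<noteq> a"
  shows "atom_state E a (full_multiple E b) = 0"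
proof -
  note b = atom_closed[OF assms(1)] atom_nonzero[OF assms(1)]
  have "multiplicity a (full_multiple E b) = 0"
    using multiplicity_other_atom[OF atom assms nmult_index[OF b]] .
  then show ?thesis using atom_state_eq[OF atom full_closed[OF b]] by simp
qed

text \<open>A state that is \<open>1\<close> at the full multiple of \<open>a\<close> dominates the atom state, and comparable
  states coincide.\<close>

lemma estate_eq_atom_state_iff:
  assumes s: "estate E s"
  shows "s = atom_state E a \<longleftrightarrow> s (full_multiple E a) = 1"
proof
  assume "s (full_multiple E a) = 1"
  then have "atom_state E a = s"
    using scaled_atom_state_le[OF s] by (intro estate_eqI_le estate_atom_state s) simp
  then show "s = atom_state E a" ..
qed (simp add: atom_state_full_multiple)

text \<open>The atom state takes the largest possible value at the full multiple of \<open>a\<close>, so both components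
  of a convex decomposition take it there too; this value determines them.\<close>

lemma extremal_atom_state: "extremal_estate E (atom_state E a)"
  unfolding extremal_estate_def
proof (intro conjI estate_atom_state allI impI; elim conjE)
  fix s1 s2 :: "'a \<Rightarrow> real" and \<alpha> :: real
  assume s: "estate E s1" "estate E s2" and \<alpha>: "0 < \<alpha>" "\<alpha> < 1"
    and eq: "atom_state E a = (\<lambda>x\<in>carrier E. \<alpha> * s1 x + (1 - \<alpha>) * s2 x)"
  let ?f = "full_multiple E a"
  have f: "?f \<in> carrier E" using full_closed atom_closed[OF atom] atom_nonzero[OF atom] by blast
  have le: "s1 ?f \<le> 1" "s2 ?f \<le> 1"
    using s estate_mono[OF _ f le_one[OF f]] estate_one by fastforce+
  have one: "\<alpha> * s1 ?f + (1 - \<alpha>) * s2 ?f = 1"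
    using atom_state_full_multiple f by (simp add: eq)
  then have "\<alpha> * (1 - s1 ?f) + (1 - \<alpha>) * (1 - s2 ?f) = 0" by (simp add: algebra_simps)
  moreover have "0 \<le> \<alpha> * (1 - s1 ?f)" "0 \<le> (1 - \<alpha>) * (1 - s2 ?f)" using le \<alpha> by simp_all
  ultimately have "\<alpha> * (1 - s1 ?f) = 0" "(1 - \<alpha>) * (1 - s2 ?f) = 0" by linarith+
  then have "s1 ?f = 1" "s2 ?f = 1" using \<alpha> by simp_all
  then show "atom_state E a = s1" "atom_state E a = s2"
    using estate_eq_atom_state_iff s by blast+
qed

text \<open>If all terms of an increasing sequence had smaller multiplicity than their supremum \<open>x\<close>, then
  \<open>a\<close> could be subtracted from \<open>x\<close> and the remainder would still be an upper bound of the
  sequence. Hence the integer-valued multiplicities become stationary at the multiplicity of \<open>x\<close>.\<close>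

lemma sigma_additive_atom_state: "sigma_additive E (atom_state E a)"
  unfolding sigma_additive_def
proof (intro allI impI; elim conjE)
  fix x :: "nat \<Rightarrow> 'a" and b
  assume xc: "\<forall>n. x n \<in> carrier E" and inc: "\<forall>n. x n \<preceq> x (Suc n)"
    and least: "least (effect_order E) b (Upper (effect_order E) (range x))"
  have "range x \<subseteq> carrier E" using xc by blast
  then have b: "b \<in> carrier E" "\<And>n. x n \<preceq> b"
      "\<And>u. u \<in> carrier E \<Longrightarrow> (\<And>n. x n \<preceq> u) \<Longrightarrow> b \<preceq> u"
    using least by (auto simp: least_upper_iff)
  let ?m = "multiplicity a"
  have mono: "?m y \<le> ?m z" if "y \<in> carrier E" "y \<preceq> z" for y z
    using that leE[of y z] multiplicity_plus[OF atom] by (metis le_add1)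
  have "\<exists>n. ?m b \<le> ?m (x n)"
  proof (rule ccontr)
    \<comment> \<open>Then \<open>a\<close> fits into every difference \<open>b \<ominus> x n\<close>, so \<open>b \<ominus> a\<close> bounds the sequence.\<close>
    assume "\<nexists>n. ?m b \<le> ?m (x n)"
    then have less: "?m (x n) < ?m b" for n by (simp add: not_le)
    then have "a \<preceq> b" using atom_le_iff[OF atom b(1)] less[of 0] by simp
    then obtain d where d: "d \<in> carrier E" "a \<boxplus> d = Some b" using leE atom_closed atom by blast
    have "x n \<preceq> d" for n
    proof -
      obtain c where c: "c \<in> carrier E" "x n \<boxplus> c = Some b" using b xc leE by blast
      then have "1 \<le> ?m c" using multiplicity_plus[OF atom _ c] less[of n] xc by auto
      then have "a \<preceq> c" using atom_le_iff[OF atom c(1)] by simp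
      then show ?thesis
        using le_difference_swap[of "x n" c a d b] c d xc atom_closed[OF atom] by blast
    qed
    then have "b \<preceq> d" using b d by blast
    moreover have "d \<preceq> b" using plus_upper d atom_closed[OF atom] by blast
    ultimately have "d = b" using le_antisym d by blast
    then show False
      using plus_eq_self[of d a] d atom_closed[OF atom] atom_nonzero[OF atom] plus_comm by simp
  qed
  then obtain N where N: "?m b \<le> ?m (x N)" by blast
  have "?m (x n) = ?m b" if n: "N \<le> n" for n
  proof -
    have "?m (x N) \<le> ?m (x n)"
      using n by (induction rule: dec_induct) (use mono xc inc order_trans in blast)+
    then show ?thesis using N mono[of "x n" b] xc b by (meson order_antisym order_trans)
  qed
  then have "eventually (\<lambda>n. atom_state E a (x n) = atom_state E a b) sequentially"
    unfolding eventually_sequentially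
    using xc b(1) by (intro exI[of _ N]) (simp add: atom_state_eq[OF atom])
  then show "(\<lambda>n. atom_state E a (x n)) \<longlonglongrightarrow> atom_state E a b"
    by (rule tendsto_eventually)
qed

text \<open>A state \<open>s\<close> dominates the atom state scaled by the positive number \<open>\<lambda> = s (\<iota>a)\<close>. Unless
  \<open>\<lambda> = 1\<close>, the normalised difference is again a state, and \<open>s\<close> is a proper convex combination of
  this difference and the atom state.\<close>

lemma extremal_eq_atom_state:
  assumes ext: "extremal_estate E s" and pos: "0 < s (full_multiple E a)"
  shows "s = atom_state E a"
proof -
  have s: "estate E s" using ext by (simp add: extremal_estate_def)
  define l where "l = s (full_multiple E a)"
  have f: "full_multiple E a \<in> carrier E"
    using full_closed atom_closed[OF atom] atom_nonzero[OF atom] by blast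
  have "l \<le> 1" using estate_mono[OF s f le_one[OF f]] estate_one[OF s] by (simp add: l_def)
  then consider "l = 1" | "l < 1" by linarith
  then show ?thesis
  proof cases
    case 1
    then show ?thesis using estate_eq_atom_state_iff[OF s] by (simp add: l_def)
  next
    case 2
    define t where "t = (\<lambda>x\<in>carrier E. (s x - l * atom_state E a x) / (1 - l))"
    note st = estate_atom_state
    have "estate E t"
    proof (rule estateI)
      show "t (eone E) = 1"
        using 2 estate_one[OF s] estate_one[OF st] one_closed by (simp add: t_def)
    next
      fix x assume "x \<in> carrier E"
      then show "0 \<le> t x" using scaled_atom_state_le[OF s] 2 by (simp add: t_def l_def)
    next
      fix x y z assume xyz: "x \<in> carrier E" "y \<in> carrier E" "x \<boxplus> y = Some z"
      then have "z \<in> carrier E" using plus_closed by blast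
      then show "t z = t x + t y"
        using xyz estate_plus[OF s xyz] estate_plus[OF st xyz]
        by (simp add: t_def add_divide_distrib[symmetric] algebra_simps)
    qed (simp add: t_def)
    moreover have "s = (\<lambda>x\<in>carrier E. l * atom_state E a x + (1 - l) * t x)"
      using estate_ext[OF s] 2 by (intro extensionalityI[of _ "carrier E"]) (auto simp: t_def)
    ultimately show ?thesis
      using ext st 2 pos unfolding extremal_estate_def l_def by blast
  qed
qed

end

end

section \<open>Decomposition of elements into multiples of atoms\<close>

context archimedean_rdp_effect_algebra
begin

text \<open>Different atoms do not interfere: the multiplicity of the next atom in a sum of multiples of
  the other atoms is zero, hence its full multiplicity in \<open>x\<close> is left in what remains of \<open>x\<close>.\<close>

lemma atom_multiples_sum_le:
  assumes "x \<in> carrier E"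
  shows "distinct js \<Longrightarrow> inj_on a (set js) \<Longrightarrow> a ` set js \<subseteq> eatoms E \<Longrightarrow>
    (\<And>j. j \<in> set js \<Longrightarrow> \<exists>k. nmult E k (a j) = Some (y j)) \<Longrightarrow>
    (\<And>j. j \<in> set js \<Longrightarrow> y j \<preceq> x) \<Longrightarrow>
    \<exists>z. list_esum E (map y js) = Some z \<and> z \<preceq> x"
proof (induction js rule: rev_induct)
  case Nil
  then show ?case using assms by (simp add: list_esum_Nil zero_le)
next
  case (snoc i js)
  have y: "y j \<in> carrier E" if "j \<in> set (js @ [i])" for j
    using snoc.prems(3,4) that nmult_closed atom_closed by (metis image_subset_iff)
  obtain z where z: "list_esum E (map y js) = Some z" "z \<preceq> x"
    using snoc by (auto simp: inj_on_def)
  have zc: "z \<in> carrier E" using list_esum_closed[OF _ z(1)] y by auto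
  obtain c where c: "c \<in> carrier E" "z \<boxplus> c = Some x" using z zc leE by blast
  have ai: "a i \<in> eatoms E" using snoc.prems by auto
  have "multiplicity (a i) z = sum_list (map (multiplicity (a i)) (map y js))"
    using y by (intro list_esum_additive multiplicity_plus[OF ai] multiplicity_zero[OF ai] z(1)) auto
  moreover have "multiplicity (a i) (y j) = 0" if j: "j \<in> set js" for j
  proof -
    have "a j \<noteq> a i" using j snoc.prems(1,2) by (auto simp: inj_on_def)
    moreover have "a j \<in> eatoms E" using j snoc.prems by auto
    ultimately show ?thesis
      using snoc.prems(4)[of j] j multiplicity_other_atom[OF ai] by auto
  qed
  ultimately have "multiplicity (a i) z = 0" by (simp add: sum_list_eq_0_iff)
  then have c_eq: "multiplicity (a i) c = multiplicity (a i) x"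
    using multiplicity_plus[OF ai zc c] by simp
  obtain k where k: "nmult E k (a i) = Some (y i)" using snoc.prems(4)[of i] by auto
  then have "y i \<preceq> c"
    using le_multiplicity_iff[OF ai assms k] le_multiplicity_iff[OF ai c(1) k] c_eq snoc.prems(5)
    by auto
  then obtain d where "d \<in> carrier E" "y i \<boxplus> d = Some c" using leE[of "y i" c] y[of i] by auto
  then obtain w where "w \<in> carrier E" "z \<boxplus> y i = Some w" "w \<boxplus> d = Some x"
    using plus_assoc_revE[of z "y i" d c x] zc y c by auto
  then show ?case
    using z plus_upper \<open>d \<in> carrier E\<close> by (auto simp: list_esum_snoc)
qed

text \<open>The part of \<open>x\<close> that the sum of the system misses lies above no atom, because every atom
  already occurs in the sum with its full multiplicity in \<open>x\<close>; by atomicity nothing is missed.\<close>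

lemma atom_multiples_system_esum:
  fixes a :: "nat \<Rightarrow> 'a"
  assumes soc: "sigma_orthocomplete E" and atomic: "eatomic E"
    and inj: "inj_on a J" and img: "a ` J = eatoms E" and x: "x \<in> carrier E"
    and y: "\<And>j. j \<in> J \<Longrightarrow> nmult E (multiplicity (a j) x) (a j) = Some (y j)"
  shows "orthogonal_system E y J" and "is_system_esum E y J x"
proof -
  have at: "a j \<in> eatoms E" if "j \<in> J" for j using img that by blast
  have yc: "y j \<in> carrier E" if "j \<in> J" for j using y at atom_closed nmult_closed that by blast
  have yx: "y j \<preceq> x" if "j \<in> J" for j
    using le_multiplicity_iff[OF at x y] that by blast
  let ?S = "{z. \<exists>F. finite F \<and> F \<subseteq> J \<and> subsystem_esum E y F = Some z}"
  have ex: "\<exists>z. subsystem_esum E y F = Some z \<and> z \<preceq> x" if F: "finite F" "F \<subseteq> J" for F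
    unfolding subsystem_esum_def
  proof (rule atom_multiples_sum_le[OF x])
    show "inj_on a (set (sorted_list_of_set F))" using inj F inj_on_subset by auto
    show "a ` set (sorted_list_of_set F) \<subseteq> eatoms E" using at F by auto
    show "\<exists>k. nmult E k (a j) = Some (y j)" "y j \<preceq> x" if "j \<in> set (sorted_list_of_set F)" for j
      using y yx F that by auto
  qed simp
  show orth: "orthogonal_system E y J"
    unfolding orthogonal_system_def
  proof (intro conjI allI impI)
    show "subsystem_esum E y F \<noteq> None" if "finite F \<and> F \<subseteq> J" for F
      using ex[of F] that by auto
  qed (use yc in simp)
  have S: "?S \<subseteq> carrier E"
  proof
    fix w assume "w \<in> ?S"
    then obtain F where F: "finite F" "F \<subseteq> J" "subsystem_esum E y F = Some w" by blast
    show "w \<in> carrier E"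
    proof (rule list_esum_closed)
      show "list_esum E (map y (sorted_list_of_set F)) = Some w"
        using F(3) unfolding subsystem_esum_def .
      show "set (map y (sorted_list_of_set F)) \<subseteq> carrier E" using F yc by auto
    qed
  qed
  obtain b where b: "is_system_esum E y J b"
    using soc orth unfolding sigma_orthocomplete_def by blast
  then have bc: "b \<in> carrier E" and ub: "\<And>z. z \<in> ?S \<Longrightarrow> z \<preceq> b"
    and lb: "\<And>u. u \<in> carrier E \<Longrightarrow> (\<And>z. z \<in> ?S \<Longrightarrow> z \<preceq> u) \<Longrightarrow> b \<preceq> u"
    using S unfolding is_system_esum_def by (auto simp: least_upper_iff)
  have "b \<preceq> x"
  proof (rule lb[OF x])
    fix w assume "w \<in> ?S"
    then obtain F where F: "finite F" "F \<subseteq> J" "subsystem_esum E y F = Some w" by blast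
    then show "w \<preceq> x" using ex[OF F(1,2)] by auto
  qed
  then obtain d where d: "d \<in> carrier E" "b \<boxplus> d = Some x" using bc leE by blast
  have "d = ezero E"
  proof (rule ccontr)
    assume "d \<noteq> ezero E"
    then obtain e where "e \<in> eatoms E" "e \<preceq> d"
      using atomic d(1) unfolding eatomic_def by blast
    then obtain j where j: "j \<in> J" "a j \<preceq> d" using img by (metis imageE)
    have "subsystem_esum E y {j} = Some (y j)"
      using zero_plus[OF yc[OF j(1)]] by (simp add: subsystem_esum_def list_esum_def)
    then have "y j \<preceq> b" using j(1) by (intro ub CollectI exI[of _ "{j}"]) simp
    then have "multiplicity (a j) x \<le> multiplicity (a j) b"
      using le_multiplicity_iff[OF at[OF j(1)] bc y[OF j(1)]] by blast
    moreover have "1 \<le> multiplicity (a j) d" using atom_le_iff[OF at[OF j(1)] d(1)] j(2) by blast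
    ultimately show False using multiplicity_plus[OF at[OF j(1)] bc d] by simp
  qed
  then have "b = x" using d(2) plus_zero[OF bc] by simp
  then show "is_system_esum E y J x" using b by simp
qed

text \<open>Summing over the initial segments of \<open>J\<close> gives an increasing sequence with the same supremum as
  all finite subsystems, so \<open>\<sigma>\<close>-additivity applies to it.\<close>

lemma sigma_additive_atom_series_nat:
  fixes a :: "nat \<Rightarrow> 'a"
  assumes soc: "sigma_orthocomplete E" and atomic: "eatomic E"
    and inj: "inj_on a J" and img: "a ` J = eatoms E" and x: "x \<in> carrier E"
    and s: "estate E s" and sigma: "sigma_additive E s"
  shows "((\<lambda>j. s (full_multiple E (a j)) * atom_state E (a j) x) has_sum s x) J"
proof -
  have at: "a j \<in> eatoms E" if "j \<in> J" for j using img that by blast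
  define y where "y j = the (nmult E (multiplicity (a j) x) (a j))" for j
  have y: "nmult E (multiplicity (a j) x) (a j) = Some (y j)" if "j \<in> J" for j
    using multiplicity_multiple[OF at x] that unfolding y_def by (metis option.sel)
  note orth = atom_multiples_system_esum(1)[OF soc atomic inj img x y]
  note sum = atom_multiples_system_esum(2)[OF soc atomic inj img x y]
  have yc: "y j \<in> carrier E" if "j \<in> J" for j using y at atom_closed nmult_closed that by blast
  have list_yc: "set (map y (sorted_list_of_set F)) \<subseteq> carrier E" if "finite F" "F \<subseteq> J" for F
    using that yc by auto
  define z where "z F = the (subsystem_esum E y F)" for F
  have z: "subsystem_esum E y F = Some (z F)" if "finite F" "F \<subseteq> J" for F
    using orth that unfolding orthogonal_system_def z_def by auto
  have zc: "z F \<in> carrier E" if "finite F" "F \<subseteq> J" for F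
    using list_esum_closed[OF list_yc] z that unfolding subsystem_esum_def by blast
  \<comment> \<open>The members of \<open>F\<close> are atom multiples below the sum over \<open>G\<close>, so their sum stays below it too.\<close>
  have mono: "z F \<preceq> z G" if FG: "F \<subseteq> G" "finite G" "G \<subseteq> J" for F G
  proof -
    have F: "finite F" "F \<subseteq> J" using FG finite_subset by auto
    have "\<exists>w. list_esum E (map y (sorted_list_of_set F)) = Some w \<and> w \<preceq> z G"
    proof (rule atom_multiples_sum_le[OF zc[OF FG(2,3)]])
      show "inj_on a (set (sorted_list_of_set F))" using inj F inj_on_subset by auto
      show "a ` set (sorted_list_of_set F) \<subseteq> eatoms E" using at F by auto
      show "\<exists>k. nmult E k (a j) = Some (y j)" if "j \<in> set (sorted_list_of_set F)" for j
        using y F that by auto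
      show "y j \<preceq> z G" if "j \<in> set (sorted_list_of_set F)" for j
      proof (rule member_le_list_esum[OF list_yc[OF FG(2,3)]])
        show "list_esum E (map y (sorted_list_of_set G)) = Some (z G)"
          using z[OF FG(2,3)] unfolding subsystem_esum_def .
        show "y j \<in> set (map y (sorted_list_of_set G))" using F FG that by auto
      qed
    qed simp
    then show ?thesis using z[OF F] unfolding subsystem_esum_def by auto
  qed
  define X where "X n = z (J \<inter> {..<n})" for n
  have "least (effect_order E) x (Upper (effect_order E) (range X))"
  proof -
    let ?S = "{w. \<exists>F. finite F \<and> F \<subseteq> J \<and> subsystem_esum E y F = Some w}"
    have S: "?S \<subseteq> carrier E"
    proof
      fix w assume "w \<in> ?S"
      then obtain F where F: "finite F" "F \<subseteq> J" "subsystem_esum E y F = Some w" by blast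
      then show "w \<in> carrier E" using z[OF F(1,2)] zc[OF F(1,2)] by simp
    qed
    have X: "range X \<subseteq> carrier E" using zc by (auto simp: X_def)
    have XS: "X n \<in> ?S" for n
      using z[of "J \<inter> {..<n}"] unfolding X_def by (intro CollectI exI[of _ "J \<inter> {..<n}"]) auto
    have lub: "\<forall>w\<in>?S. w \<preceq> x" "\<forall>u\<in>carrier E. (\<forall>w\<in>?S. w \<preceq> u) \<longrightarrow> x \<preceq> u"
      using sum least_upper_iff[OF S, of x] unfolding is_system_esum_def by blast+
    have bound: "\<forall>w\<in>?S. w \<preceq> u" if u: "\<forall>n. X n \<preceq> u" for u
    proof
      fix w assume "w \<in> ?S"
      then obtain F where F: "finite F" "F \<subseteq> J" "subsystem_esum E y F = Some w" by blast
      then have w: "w = z F" using z[OF F(1,2)] by simp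
      obtain n where n: "F \<subseteq> {..<n}" using F(1) finite_nat_iff_bounded by blast
      have "w \<preceq> X n" unfolding w X_def by (rule mono) (use F n in auto)
      then show "w \<preceq> u" using u zc[OF F(1,2)] w le_trans by blast
    qed
    show ?thesis unfolding least_upper_iff[OF X]
    proof (intro conjI ballI impI x)
      show "w \<preceq> x" if "w \<in> range X" for w using that lub(1) XS by auto
      show "x \<preceq> u" if "u \<in> carrier E" "\<forall>w\<in>range X. w \<preceq> u" for u
      proof (rule lub(2)[rule_format, OF that(1)])
        fix w assume "w \<in> ?S"
        then show "w \<preceq> u" by (rule bound[rule_format, rotated]) (use that(2) in simp)
      qed
    qed
  qed
  moreover have "X n \<preceq> X (Suc n)" for n
    unfolding X_def by (rule mono) auto
  moreover have "X n \<in> carrier E" for n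
    unfolding X_def by (rule zc) auto
  ultimately have lim: "(\<lambda>n. s (X n)) \<longlonglongrightarrow> s x"
    by (intro sigma[unfolded sigma_additive_def, rule_format]) simp
  define f where "f j = (if j \<in> J then s (y j) else 0)" for j
  have "s (X n) = (\<Sum>j<n. f j)" for n
  proof -
    let ?F = "J \<inter> {..<n}"
    have "s (z ?F) = sum_list (map s (map y (sorted_list_of_set ?F)))"
      by (rule list_esum_additive[where f = s, OF estate_plus[OF s] estate_zero[OF s] list_yc])
        (use z[of ?F] in \<open>simp_all add: subsystem_esum_def\<close>)
    also have "\<dots> = (\<Sum>j\<in>?F. s (y j))" by (simp add: sum_list_distinct_conv_sum_set comp_def)
    also have "\<dots> = (\<Sum>j<n. f j)"
      unfolding f_def Int_commute[of J] by (rule sum.inter_restrict) simp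
    finally show ?thesis by (simp add: X_def)
  qed
  then have "f sums s x" using lim by (simp add: sums_def)
  moreover have "0 \<le> f j" for j using estate_nonneg[OF s] yc by (simp add: f_def)
  ultimately have "(f has_sum s x) UNIV" by (rule sums_nonneg_imp_has_sum)
  moreover have "(f has_sum s x) UNIV \<longleftrightarrow>
      ((\<lambda>j. s (full_multiple E (a j)) * atom_state E (a j) x) has_sum s x) J"
  proof (rule has_sum_cong_neutral)
    show "f j = s (full_multiple E (a j)) * atom_state E (a j) x" if "j \<in> UNIV \<inter> J" for j
      using that scaled_atom_state[OF at s x y, of j] by (simp add: f_def)
  qed (simp_all add: f_def)
  ultimately show ?thesis by blast
qed

lemma sigma_additive_atom_series:
  assumes "sigma_orthocomplete E" "eatomic E"
    and bij: "bij_betw atm I (eatoms E)" and "countable I"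
    and "x \<in> carrier E" "estate E s" "sigma_additive E s"
  shows "((\<lambda>i. s (full_multiple E (atm i)) * atom_state E (atm i) x) has_sum s x) I"
proof -
  let ?n = "to_nat_on I" and ?a = "\<lambda>j. atm (from_nat_into I j)"
  have n: "inj_on ?n I" using \<open>countable I\<close> by (rule inj_on_to_nat_on)
  have inv: "from_nat_into I (?n i) = i" if "i \<in> I" for i using that \<open>countable I\<close> by simp
  have "bij_betw (from_nat_into I) (?n ` I) I"
    by (rule bij_betw_byWitness[where f' = ?n]) (use inv in auto)
  then have "bij_betw ?a (?n ` I) (eatoms E)"
    using bij_betw_trans[OF _ bij] by (simp add: comp_def)
  then have "((\<lambda>j. s (full_multiple E (?a j)) * atom_state E (?a j) x) has_sum s x) (?n ` I)"
    by (intro sigma_additive_atom_series_nat assms) (auto simp: bij_betw_def)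
  then have "((\<lambda>j. s (full_multiple E (?a j)) * atom_state E (?a j) x) \<circ> ?n has_sum s x) I"
    using has_sum_reindex[OF n] by blast
  moreover have "(((\<lambda>j. s (full_multiple E (?a j)) * atom_state E (?a j) x) \<circ> ?n) has_sum s x) I \<longleftrightarrow>
      ((\<lambda>i. s (full_multiple E (atm i)) * atom_state E (atm i) x) has_sum s x) I"
    by (rule has_sum_cong) (simp add: inv)
  ultimately show ?thesis by blast
qed

end

theorem theorem5p3:
  fixes E :: "('a, 'm) effect_struct_scheme"
    and I :: "'i set"
    and atm :: "'i \<Rightarrow> 'a"
  assumes "effect_algebra E"
    and "sigma_orthocomplete E"
    and "eatomic E"
    and "RDP E"
    and "bij_betw atm I (eatoms E)"
    and "countable I"
  shows "(\<forall>i\<in>I. extremal_estate E (atom_state E (atm i)) \<and>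
                 sigma_additive E (atom_state E (atm i)))
       \<and> (\<forall>s. estate E s \<and> sigma_additive E s \<longrightarrow>
            (\<forall>a\<in>carrier E.
               ((\<lambda>i. s (full_multiple E (atm i)) * atom_state E (atm i) a) has_sum s a) I))
       \<and> (\<forall>s. extremal_estate E s \<and> sigma_additive E s \<longrightarrow>
            (\<exists>!i. i \<in> I \<and> s = atom_state E (atm i)))
       \<and> (\<forall>s. \<forall>i\<in>I. estate E s \<longrightarrow>
            (s = atom_state E (atm i) \<longleftrightarrow> s (full_multiple E (atm i)) = 1))"
proof -
  interpret effect_algebra E by fact
  interpret archimedean_rdp_effect_algebra E
    using \<open>RDP E\<close> sigma_orthocomplete_isotropic_index_finite[OF \<open>sigma_orthocomplete E\<close>]
    by unfold_locales
  note bij = \<open>bij_betw atm I (eatoms E)\<close>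
  have at: "atm i \<in> eatoms E" if "i \<in> I" for i using bij that by (auto simp: bij_betw_def)
  note series = sigma_additive_atom_series[OF \<open>sigma_orthocomplete E\<close> \<open>eatomic E\<close> bij \<open>countable I\<close>]
  have unique: "\<exists>!i. i \<in> I \<and> s = atom_state E (atm i)"
    if ext: "extremal_estate E s" and sigma: "sigma_additive E s" for s
  proof -
    have s: "estate E s" using ext by (simp add: extremal_estate_def)
    have "\<exists>i\<in>I. s (full_multiple E (atm i)) \<noteq> 0"
    proof (rule ccontr)
      assume "\<not> ?thesis"
      then have zero: "s (full_multiple E (atm i)) * atom_state E (atm i) (eone E) = 0"
        if "i \<in> I" for i using that by simp
      have "((\<lambda>_. 0) has_sum s (eone E)) I"
        by (rule iffD1[OF has_sum_cong series[OF one_closed s sigma]]) (rule zero)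
      moreover have "((\<lambda>_. 0::real) has_sum 0) I" by simp
      ultimately have "s (eone E) = 0" by (rule has_sum_unique)
      then show False using estate_one[OF s] by simp
    qed
    then obtain i where i: "i \<in> I" "s (full_multiple E (atm i)) \<noteq> 0" by blast
    have "0 \<le> s (full_multiple E (atm i))"
      by (intro estate_nonneg[OF s] full_closed atom_closed atom_nonzero at i(1))
    then have "0 < s (full_multiple E (atm i))" using i(2) by simp
    then have si: "s = atom_state E (atm i)" by (rule extremal_eq_atom_state[OF at[OF i(1)] ext])
    \<comment> \<open>Different atoms give different states: they are separated by the full multiples.\<close>
    have "j = i" if j: "j \<in> I" "s = atom_state E (atm j)" for j
    proof (rule ccontr)
      assume "j \<noteq> i"
      then have "atm j \<noteq> atm i" using bij i j by (auto simp: bij_betw_def inj_on_def)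
      then have "s (full_multiple E (atm j)) = 0"
        unfolding si by (rule atom_state_full_multiple_other[OF at[OF i(1)] at[OF j(1)]])
      then show False unfolding j(2) using atom_state_full_multiple[OF at[OF j(1)]] by simp
    qed
    then show ?thesis using i si by blast
  qed
  show ?thesis
  proof (intro conjI ballI allI impI; (elim conjE)?)
    show "extremal_estate E (atom_state E (atm i))" "sigma_additive E (atom_state E (atm i))"
      if "i \<in> I" for i
      using extremal_atom_state[OF at] sigma_additive_atom_state[OF at] that by simp_all
    show "s = atom_state E (atm i) \<longleftrightarrow> s (full_multiple E (atm i)) = 1"
      if "i \<in> I" "estate E s" for s i
      using estate_eq_atom_state_iff[OF at[OF that(1)] that(2)] .
  qed (fact series unique)+
qed

end
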